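(* Let $(A,\wedge,\vee,\to_w,\sim,1)$ be a Nelson algebra, and put $0=\sim 1$. Let $Ob$ be the set of all prime filters of $A$ ordered by $R={\subseteq}$, and let $\mathcal O_R$ with the operations $\cap,\cup,\sim$ and $G\to_w H=G\Rightarrow(\sim G\cup H)$ be as in the context. Then there exists an injective map $h:A\to\mathcal O_R$ such that for all $a,b\in A$: $h(0)=\emptyset$, $h(1)=Ob$, $h(a\wedge b)=h(a)\cap h(b)$, $h(a\vee b)=h(a)\cup h(b)$, $h(\sim a)=\sim h(a)$ and $h(a\to_w b)=h(a)\to_w h(b)$.
   Context: A Nelson algebra $(A,\wedge,\vee,\to_w,\sim,1)$ is an algebra such that $(A,\wedge,\vee,\sim,1)$ is a Kleene algebra (a bounded distributive lattice with $\sim\sim a=a$, $\sim(a\wedge b)=\sim a\vee\sim b$, $a\wedge\sim a\le b\vee\sim b$) and for all $a,b,c$: $a\to_w a=1$; $a\wedge(a\to_w b)=a\wedge(\sim a\vee b)$; $a\to_w(b\to_w c)=(a\wedge b)\to_w c$. Prime filters are proper lattice filters $P$ with $a\vee b\in P\Rightarrow a\in P$ or $b\in P$. For $P\in Ob$ let $\varphi(P)=A\setminus\{\sim p:p\in P\}$ and $R(P)=\{Q\in Ob:P\subseteq Q\}$. For $X\subseteq Ob$: $I_RX=\bigcup\{R(P):P\in Ob,\ R(P)\subseteq X\}$, $\varphi(X)=\{\varphi(P):P\in X\}$, $\sim X=Ob\setminus\varphi(X)$; $\mathcal O_R=\{X\subseteq Ob:I_RX=X\}$, and for $G,H\in\mathcal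 O_R$, $G\Rightarrow H=I_R((Ob\setminus G)\cup H)$. *)

theory Defs
  imports Main
begin

text \<open>Meet, join, unit and order are the library's \<^const>\<open>inf\<close>, \<^const>\<open>sup\<close>, \<^const>\<open>top\<close>
  and \<open>\<le>\<close>. The least element \<^const>\<open>bot\<close> comes with \<^class>\<open>bounded_lattice\<close>; the axioms
  below force it to be the negation of \<^const>\<open>top\<close>.\<close>

class kleene_algebra = distrib_lattice + bounded_lattice +
  fixes neg :: "'a \<Rightarrow> 'a"
  assumes neg_neg: "neg (neg a) = a"
    and neg_inf: "neg (inf a b) = sup (neg a) (neg b)"
    and kleene: "inf a (neg a) \<le> sup b (neg b)"

class nelson_algebra = kleene_algebra +
  fixes wimp :: "'a \<Rightarrow> 'a \<Rightarrow> 'a"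
  assumes wimp_refl: "wimp a a = top"
    and inf_wimp: "inf a (wimp a b) = inf a (sup (neg a) b)"
    and wimp_wimp: "wimp a (wimp b c) = wimp (inf a b) c"

definition lattice_filter :: "'a::lattice set \<Rightarrow> bool" where
  "lattice_filter F \<longleftrightarrow> F \<noteq> {} \<and> (\<forall>a\<in>F. \<forall>b\<in>F. inf a b \<in> F) \<and> (\<forall>a\<in>F. \<forall>b. a \<le> b \<longrightarrow> b \<in> F)"

definition prime_filter :: "'a::lattice set \<Rightarrow> bool" where
  "prime_filter P \<longleftrightarrow>
     lattice_filter P \<and> P \<noteq> UNIV \<and> (\<forall>a b. sup a b \<in> P \<longrightarrow> a \<in> P \<or> b \<in> P)"

definition Ob :: "'a::lattice set set" where
  "Ob = {P. prime_filter P}"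

definition phi :: "'a::kleene_algebra set \<Rightarrow> 'a set" where
  "phi P = UNIV - neg ` P"

definition R :: "'a::lattice set \<Rightarrow> 'a set set" where
  "R P = {Q \<in> Ob. P \<subseteq> Q}"

definition I_R :: "'a::lattice set set \<Rightarrow> 'a set set" where
  "I_R X = \<Union> {R P | P. P \<in> Ob \<and> R P \<subseteq> X}"

definition set_neg :: "'a::kleene_algebra set set \<Rightarrow> 'a set set" where
  "set_neg X = Ob - phi ` X"

definition O_R :: "'a::lattice set set set" where
  "O_R = {X. X \<subseteq> Ob \<and> I_R X = X}"

definition set_imp :: "'a::lattice set set \<Rightarrow> 'a set set \<Rightarrow> 'a set set" where
  "set_imp G H = I_R ((Ob - G) \<union> H)"

definition set_wimp :: "'a::kleene_algebra set set \<Rightarrow> 'a set set \<Rightarrow> 'a set set" where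
  "set_wimp G H = set_imp G (set_neg G \<union> H)"

end

theory Submission
  imports Defs
begin

text \<open>The map is the Stone map sending \<open>a\<close> to the set of prime filters containing \<open>a\<close>. Everything
  except the implication is the usual duality for Kleene algebras. For the implication one needs the
  residuation law \<open>c \<le> a \<rightarrow> b \<longleftrightarrow> c \<sqinter> a \<le> \<sim>a \<squnion> b\<close>: if a prime filter \<open>P\<close> omits \<open>a \<rightarrow> b\<close>, then the
  filter generated by \<open>P\<close> and \<open>a\<close> omits \<open>\<sim>a \<squnion> b\<close>, and a prime extension of it omitting \<open>\<sim>a \<squnion> b\<close>
  shows that \<open>P\<close> is not in the right-hand side.\<close>

section \<open>Kleene and Nelson algebras\<close>

context kleene_algebra
begin

lemma neg_sup: "neg (sup a b) = inf (neg a) (neg b)"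
  by (metis neg_inf neg_neg)

lemma neg_antimono: "a \<le> b \<Longrightarrow> neg b \<le> neg a"
  by (metis inf.absorb_iff1 neg_inf sup.cobounded2)

lemma neg_top: "neg top = bot"
  by (metis neg_antimono neg_neg bot.extremum_unique top_greatest)

lemma neg_bot: "neg bot = top"
  using neg_top neg_neg by metis

end

context nelson_algebra
begin

lemma wimp_top: "wimp a top = top"
  by (metis inf.idem wimp_refl wimp_wimp)

text \<open>As \<open>inf a b = a\<close>, uncurrying turns \<open>wimp a b\<close> into
  \<open>wimp a (wimp b b)\<close>, that is \<open>wimp a top\<close>.\<close>

lemma wimp_eq_top_if_le: "a \<le> b \<Longrightarrow> wimp a b = top"
  by (metis inf.absorb1 wimp_refl wimp_top wimp_wimp)

lemma le_neg_sup_if_wimp_eq_top: "wimp a b = top \<Longrightarrow> a \<le> sup (neg a) b"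
  by (metis inf_wimp inf_top_right inf.cobounded2)

text \<open>Currying absorbs a repeated \<open>a\<close>: \<open>wimp (inf c a) (wimp a b)\<close>
  equals \<open>wimp c (wimp a b)\<close>, and the former is \<open>top\<close> since
  \<open>inf c a \<le> wimp a b\<close>.\<close>

lemma wimp_wimp_eq_top:
  assumes "inf c a \<le> sup (neg a) b"
  shows "wimp c (wimp a b) = top"
proof -
  have "inf c a \<le> inf a (sup (neg a) b)"
    using assms by simp
  then have "inf c a \<le> wimp a b"
    by (metis inf_wimp inf.boundedE)
  then have "wimp (inf c a) (wimp a b) = top"
    by (rule wimp_eq_top_if_le)
  then show ?thesis
    by (simp add: wimp_wimp inf.assoc)
qed

text \<open>From right to left, \<open>wimp c d = top\<close> gives only
  \<open>c \<le> sup (neg c) d\<close>, where \<open>d\<close> is \<open>wimp a b\<close>. It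
  remains to bound \<open>inf c (neg c)\<close> by \<open>d\<close>, which the Kleene inequality
  reduces to bounding \<open>inf c (neg d)\<close>.\<close>

lemma le_wimp_iff: "c \<le> wimp a b \<longleftrightarrow> inf c a \<le> sup (neg a) b"
proof
  assume "c \<le> wimp a b"
  then have "inf c a \<le> inf a (wimp a b)"
    by (simp add: le_infI1)
  then show "inf c a \<le> sup (neg a) b"
    by (simp add: inf_wimp)
next
  assume le: "inf c a \<le> sup (neg a) b"
  define d where "d = wimp a b"
  have "inf c a \<le> inf a (sup (neg a) b)"
    using le by simp
  then have ca: "inf c a \<le> d"
    unfolding d_def by (metis inf_wimp inf.boundedE)
  have c: "c \<le> sup (neg c) d"
    unfolding d_def by (rule le_neg_sup_if_wimp_eq_top, rule wimp_wimp_eq_top, rule le)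
  \<comment> \<open>The previous argument with \<open>neg a\<close> in place of \<open>c\<close>,
    where the hypothesis is trivial.\<close>
  have "wimp (neg a) d = top"
    unfolding d_def by (rule wimp_wimp_eq_top) (simp add: le_supI1 le_infI1)
  then have na: "neg a \<le> sup a d"
    using le_neg_sup_if_wimp_eq_top[of "neg a" d] by (simp add: neg_neg)
  \<comment> \<open>Negate both sides of \<open>inf a d = inf a (sup (neg a) b)\<close> by De
    Morgan.\<close>
  have "sup (neg a) (neg d) = sup (neg a) (inf a (neg b))"
    unfolding d_def by (metis inf_wimp neg_inf neg_sup neg_neg)
  then have "neg d \<le> sup (neg a) (inf a (neg b))"
    by (metis sup.cobounded2)
  also have "\<dots> \<le> sup (neg a) a"
    by (rule sup_mono) simp_all
  finally have nd: "neg d \<le> sup (neg a) a" .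
  have "neg d \<le> sup a d"
    using nd na by (meson order.trans sup.boundedI sup.cobounded1)
  then have "inf c (neg d) \<le> inf c (sup a d)"
    by (rule inf_mono[OF order.refl])
  also have "\<dots> \<le> d"
    by (simp add: inf_sup_distrib1 ca)
  finally have cnd: "inf c (neg d) \<le> d" .
  \<comment> \<open>The Kleene inequality splits \<open>c \<sqinter> \<sim>c\<close> along \<open>d\<close> and \<open>\<sim>d\<close>.\<close>
  have "inf c (neg c) \<le> inf c (sup d (neg d))"
    using kleene[of c d] by simp
  also have "\<dots> \<le> d"
    by (simp add: inf_sup_distrib1 cnd)
  finally have "inf c (neg c) \<le> d" .
  moreover have "c \<le> inf c (sup (neg c) d)"
    using c by simp
  ultimately have "c \<le> d"
    by (metis inf_sup_distrib1 inf.coboundedI2 order.refl order.trans sup.boundedI)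
  then show "c \<le> wimp a b"
    by (simp add: d_def)
qed

end

section \<open>Prime filters\<close>

lemma lattice_filter_inf_iff: "lattice_filter F \<Longrightarrow> inf a b \<in> F \<longleftrightarrow> a \<in> F \<and> b \<in> F"
  unfolding lattice_filter_def using inf.cobounded1[of a b] inf.cobounded2[of a b] by blast

lemma lattice_filter_nonempty: "lattice_filter F \<Longrightarrow> F \<noteq> {}"
  unfolding lattice_filter_def by simp

lemma lattice_filter_upward: "lattice_filter F \<Longrightarrow> a \<in> F \<Longrightarrow> a \<le> b \<Longrightarrow> b \<in> F"
  unfolding lattice_filter_def by blast

lemma lattice_filter_top: "lattice_filter F \<Longrightarrow> (top :: 'a::bounded_lattice) \<in> F"
  using lattice_filter_nonempty[of F] lattice_filter_upward[of F _ top] by auto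

lemma lattice_filter_principal: "lattice_filter {x. a \<le> x}"
  unfolding lattice_filter_def by auto

text \<open>This set is the filter generated by \<open>F\<close> and \<open>a\<close>.\<close>

lemma lattice_filter_adjoin:
  fixes F :: "'a::lattice set"
  assumes "lattice_filter F"
  shows "lattice_filter {x. \<exists>p\<in>F. inf p a \<le> x}" (is "lattice_filter ?G")
  unfolding lattice_filter_def
proof (intro conjI ballI allI impI)
  obtain p where "p \<in> F"
    using lattice_filter_nonempty[OF assms] by blast
  then have "p \<in> ?G"
    using inf.cobounded1 by blast
  then show "?G \<noteq> {}"
    by blast
next
  fix x y assume "x \<in> ?G" "y \<in> ?G"
  then obtain p q where pq: "p \<in> F" "inf p a \<le> x" "q \<in> F" "inf q a \<le> y"
    by blast
  have "inf (inf p q) a \<le> inf p a" "inf (inf p q) a \<le> inf q a"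
    by (simp_all add: inf.coboundedI1)
  then have "inf (inf p q) a \<le> inf x y"
    using pq by (meson le_inf_iff order_trans)
  moreover have "inf p q \<in> F"
    using pq assms by (simp add: lattice_filter_inf_iff)
  ultimately show "inf x y \<in> ?G"
    by blast
next
  fix x y assume "x \<in> ?G" "x \<le> y"
  then show "y \<in> ?G"
    using order_trans by blast
qed

text \<open>Members of a chain are comparable, so any two elements of the union already lie in a
  common filter. This supplies the upper bounds for Zorn's lemma.\<close>

lemma lattice_filter_Union_chain:
  assumes "subset.chain {F. lattice_filter F} C" and "C \<noteq> {}"
  shows "lattice_filter (\<Union>C)"
  unfolding lattice_filter_def
proof (intro conjI ballI allI impI)
  have filt: "lattice_filter F" if "F \<in> C" for F
    using assms(1) that by (auto simp: subset_chain_def)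
  obtain F where "F \<in> C"
    using assms(2) by blast
  then show "\<Union>C \<noteq> {}"
    using lattice_filter_nonempty[OF filt] by blast
  fix x assume x: "x \<in> \<Union>C"
  show "inf x y \<in> \<Union>C" if y: "y \<in> \<Union>C" for y
  proof -
    obtain F G where "F \<in> C" "x \<in> F" "G \<in> C" "y \<in> G"
      using x y by blast
    moreover from this have "F \<subseteq> G \<or> G \<subseteq> F"
      using assms(1) by (auto simp: subset_chain_def)
    ultimately obtain H where "H \<in> C" "x \<in> H" "y \<in> H"
      by blast
    then show ?thesis
      using filt lattice_filter_inf_iff by blast
  qed
  show "y \<in> \<Union>C" if "x \<le> y" for y
    using x that filt lattice_filter_upward by blast
qed

text \<open>A filter maximal among those containing \<open>F\<close> and omitting \<open>x\<close>
  is prime: if it missed both \<open>a\<close> and \<open>b\<close>, adjoining either would capture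
  \<open>x\<close>, and distributivity would then put \<open>x\<close> into it as soon as it
  contains \<open>sup a b\<close>.\<close>

theorem prime_filter_extension:
  fixes F :: "'a::distrib_lattice set"
  assumes F: "lattice_filter F" and x: "x \<notin> F"
  obtains P where "prime_filter P" "F \<subseteq> P" "x \<notin> P"
proof -
  let ?S = "{G. lattice_filter G \<and> F \<subseteq> G \<and> x \<notin> G}"
  have "\<exists>M\<in>?S. \<forall>G\<in>?S. M \<subseteq> G \<longrightarrow> G = M"
  proof (rule subset_Zorn_nonempty)
    show "?S \<noteq> {}"
      using F x by blast
    fix C assume C: "C \<noteq> {}" "subset.chain ?S C"
    then have "subset.chain {G. lattice_filter G} C"
      by (auto simp: subset_chain_def)
    then show "\<Union>C \<in> ?S"
      using C lattice_filter_Union_chain[of C] by (auto simp: subset_chain_def)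
  qed
  then obtain M where "M \<in> ?S" and max: "\<forall>G\<in>?S. M \<subseteq> G \<longrightarrow> G = M"
    by (rule bexE)
  then have M: "lattice_filter M" "F \<subseteq> M" "x \<notin> M"
    by simp_all
  have maxi: "G = M" if "lattice_filter G" "x \<notin> G" "M \<subseteq> G" for G
    using max that M(2) by simp
  \<comment> \<open>By maximality, the filter generated by \<open>M\<close> and a new element
    contains \<open>x\<close>.\<close>
  have adjoin: "\<exists>p\<in>M. inf p a \<le> x" if "a \<notin> M" for a
  proof (rule ccontr)
    let ?G = "{y. \<exists>p\<in>M. inf p a \<le> y}"
    assume "\<not> (\<exists>p\<in>M. inf p a \<le> x)"
    moreover have "M \<subseteq> ?G"
      using inf.cobounded1 by blast
    ultimately have "?G = M"
      using maxi[OF lattice_filter_adjoin[OF M(1), of a]] by simp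
    moreover have "a \<in> ?G"
      using lattice_filter_nonempty[OF M(1)] by (auto intro: inf.cobounded2)
    ultimately show False
      using that by blast
  qed
  have "a \<in> M \<or> b \<in> M" if ab: "sup a b \<in> M" for a b
  proof (rule ccontr)
    assume "\<not> (a \<in> M \<or> b \<in> M)"
    then obtain p q where pq: "p \<in> M" "inf p a \<le> x" "q \<in> M" "inf q b \<le> x"
      using adjoin by blast
    have "inf (inf p q) a \<le> x" "inf (inf p q) b \<le> x"
      using order_trans[OF inf_mono[OF inf.cobounded1 order_refl] pq(2)]
        order_trans[OF inf_mono[OF inf.cobounded2 order_refl] pq(4)] by simp_all
    then have "inf (inf p q) (sup a b) \<le> x"
      by (simp add: inf_sup_distrib1)
    moreover have "inf (inf p q) (sup a b) \<in> M"
      using pq ab M(1) by (simp add: lattice_filter_inf_iff)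
    ultimately show False
      using M lattice_filter_upward by blast
  qed
  then have "prime_filter M"
    using M unfolding prime_filter_def by blast
  then show ?thesis
    using that M by blast
qed

lemma Ob_lattice_filter: "P \<in> Ob \<Longrightarrow> lattice_filter P"
  by (simp add: Ob_def prime_filter_def)

lemma Ob_sup_iff: "P \<in> Ob \<Longrightarrow> sup a b \<in> P \<longleftrightarrow> a \<in> P \<or> b \<in> P"
  unfolding Ob_def prime_filter_def
  using lattice_filter_upward[of P _ "sup a b"] by auto

lemma Ob_bot: "P \<in> Ob \<Longrightarrow> (bot :: 'a::bounded_lattice) \<notin> P"
  unfolding Ob_def prime_filter_def using lattice_filter_upward[of P bot] by auto

section \<open>The involution on prime filters\<close>

lemma mem_phi_iff: "a \<in> phi P \<longleftrightarrow> neg a \<notin> P"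
  unfolding phi_def by (metis Diff_iff UNIV_I image_iff neg_neg)

lemma phi_phi: "phi (phi P) = P"
  by (auto simp: mem_phi_iff neg_neg)

text \<open>Passing to \<open>phi P\<close> combines complement with negation, so De Morgan
  exchanges the two roles: closure under meets comes from primeness of \<open>P\<close>, and
  primeness from closure of \<open>P\<close> under meets.\<close>

lemma phi_Ob:
  assumes "P \<in> Ob"
  shows "phi P \<in> Ob"
proof -
  note F = Ob_lattice_filter[OF assms]
  have "lattice_filter (phi P)"
    unfolding lattice_filter_def
  proof (intro conjI ballI allI impI)
    have "top \<in> phi P"
      using Ob_bot[OF assms] by (simp add: mem_phi_iff neg_top)
    then show "phi P \<noteq> {}"
      by blast
    show "inf a b \<in> phi P" if "a \<in> phi P" "b \<in> phi P" for a b
      using that assms by (simp add: mem_phi_iff neg_inf Ob_sup_iff)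
    show "b \<in> phi P" if "a \<in> phi P" "a \<le> b" for a b
      using that F lattice_filter_upward neg_antimono by (metis mem_phi_iff)
  qed
  moreover have "bot \<notin> phi P"
    using F by (simp add: mem_phi_iff neg_bot lattice_filter_top)
  moreover have "a \<in> phi P \<or> b \<in> phi P" if "sup a b \<in> phi P" for a b
    using that F by (simp add: mem_phi_iff neg_sup lattice_filter_inf_iff)
  ultimately show ?thesis
    unfolding Ob_def prime_filter_def by blast
qed

section \<open>The Stone map\<close>

text \<open>Since \<open>R\<close> is reflexive and transitive, \<open>I_R\<close> is the interior
  operator of the topology of up-sets of \<open>Ob\<close>.\<close>

lemma I_R_eq: "I_R X = {P \<in> Ob. R P \<subseteq> X}"
  unfolding I_R_def R_def by blast

definition stone :: "'a::lattice \<Rightarrow> 'a set set" where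
  "stone a = {P \<in> Ob. a \<in> P}"

lemma stone_in_O_R: "stone a \<in> O_R"
  unfolding O_R_def I_R_eq stone_def R_def by auto

text \<open>If \<open>a \<le> b\<close> fails, the principal filter of \<open>a\<close> omits
  \<open>b\<close> and extends to a prime filter separating the two.\<close>

lemma inj_stone: "inj (stone :: 'a::distrib_lattice \<Rightarrow> 'a set set)"
proof (rule injI)
  have le: "a \<le> b" if "stone a = stone b" for a b :: 'a
  proof (rule ccontr)
    assume "\<not> a \<le> b"
    then obtain P where "prime_filter P" "{x. a \<le> x} \<subseteq> P" "b \<notin> P"
      using prime_filter_extension[OF lattice_filter_principal, of b a] by auto
    then have "P \<in> stone a" "P \<notin> stone b"
      by (auto simp: stone_def Ob_def)
    then show False
      using that by simp
  qed
  show "a = b" if "stone a = stone b" for a b :: 'a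
    using le[OF that] le[OF that[symmetric]] by simp
qed

lemma stone_bot: "stone (bot :: 'a::bounded_lattice) = {}"
  by (auto simp: stone_def Ob_bot)

lemma stone_top: "stone (top :: 'a::bounded_lattice) = Ob"
  by (auto simp: stone_def Ob_lattice_filter lattice_filter_top)

lemma stone_inf: "stone (inf a b) = stone a \<inter> stone b"
  by (auto simp: stone_def lattice_filter_inf_iff Ob_lattice_filter)

lemma stone_sup: "stone (sup a b) = stone a \<union> stone b"
  by (auto simp: stone_def Ob_sup_iff)

lemma stone_neg: "stone (neg a) = set_neg (stone a)"
proof -
  have "P \<in> phi ` stone a \<longleftrightarrow> neg a \<notin> P" if "P \<in> Ob" for P
  proof
    show "neg a \<notin> P" if "P \<in> phi ` stone a"
      using that by (auto simp: stone_def mem_phi_iff neg_neg)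
    \<comment> \<open>As \<open>phi\<close> is an involution on \<open>Ob\<close>, the preimage of
      \<open>P\<close> is \<open>phi P\<close>.\<close>
    show "P \<in> phi ` stone a" if "neg a \<notin> P"
      using that \<open>P \<in> Ob\<close>
      by (intro image_eqI[of _ _ "phi P"]) (auto simp: stone_def phi_phi phi_Ob mem_phi_iff)
  qed
  then show ?thesis
    by (auto simp: set_neg_def stone_def)
qed

lemma stone_wimp: "stone (wimp a b) = set_wimp (stone a) (stone b)"
proof -
  \<comment> \<open>The right-hand side is membership of \<open>P\<close> in the interior defining
    \<open>set_wimp\<close>, written out elementwise.\<close>
  have "wimp a b \<in> P \<longleftrightarrow> (\<forall>Q\<in>Ob. P \<subseteq> Q \<longrightarrow> a \<in> Q \<longrightarrow> sup (neg a) b \<in> Q)"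
    if P: "P \<in> Ob" for P
  proof (intro iffI ballI impI)
    fix Q assume Q: "wimp a b \<in> P" "Q \<in> Ob" "P \<subseteq> Q" "a \<in> Q"
    then have "inf a (wimp a b) \<in> Q"
      by (auto simp: lattice_filter_inf_iff Ob_lattice_filter)
    then show "sup (neg a) b \<in> Q"
      using Q(2) by (simp add: inf_wimp lattice_filter_inf_iff Ob_lattice_filter)
  next
    assume ext: "\<forall>Q\<in>Ob. P \<subseteq> Q \<longrightarrow> a \<in> Q \<longrightarrow> sup (neg a) b \<in> Q"
    note F = Ob_lattice_filter[OF P]
    let ?G = "{x. \<exists>p\<in>P. inf p a \<le> x}"
    show "wimp a b \<in> P"
    proof (rule ccontr)
      assume "wimp a b \<notin> P"
      \<comment> \<open>Otherwise some \<open>p\<close> in \<open>P\<close> satisfies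
        \<open>inf p a \<le> sup (neg a) b\<close>; residuation gives
        \<open>p \<le> wimp a b\<close>, which puts \<open>wimp a b\<close> into
        \<open>P\<close>.\<close>
      then have "sup (neg a) b \<notin> ?G"
        using F by (auto simp: le_wimp_iff[symmetric] dest: lattice_filter_upward)
      then obtain Q where Q: "prime_filter Q" "?G \<subseteq> Q" "sup (neg a) b \<notin> Q"
        using prime_filter_extension[OF lattice_filter_adjoin[OF F]] by blast
      have "P \<subseteq> ?G"
        using inf.cobounded1 by blast
      moreover have "a \<in> ?G"
        using lattice_filter_top[OF F] inf.cobounded2 by blast
      ultimately have "P \<subseteq> Q" "a \<in> Q"
        using Q(2) by (simp_all only: order_trans subsetD)
      then show False
        using ext Q unfolding Ob_def by blast
    qed
  qed
  then have "stone (wimp a b) =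
      {P \<in> Ob. \<forall>Q\<in>Ob. P \<subseteq> Q \<longrightarrow> Q \<in> stone a \<longrightarrow> Q \<in> stone (sup (neg a) b)}"
    by (auto simp: stone_def)
  also have "\<dots> = I_R ((Ob - stone a) \<union> stone (sup (neg a) b))"
    unfolding I_R_eq R_def by auto
  also have "\<dots> = set_wimp (stone a) (stone b)"
    by (simp add: set_wimp_def set_imp_def stone_sup stone_neg)
  finally show ?thesis .
qed

theorem theorem3p10:
  shows "\<exists>h :: 'a::nelson_algebra \<Rightarrow> 'a set set.
    inj h \<and> range h \<subseteq> O_R \<and>
    h (neg top) = {} \<and> h top = Ob \<and>
    (\<forall>a b. h (inf a b) = h a \<inter> h b) \<and>
    (\<forall>a b. h (sup a b) = h a \<union> h b) \<and>
    (\<forall>a. h (neg a) = set_neg (h a)) \<and>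
    (\<forall>a b. h (wimp a b) = set_wimp (h a) (h b))"
  by (rule exI[of _ stone])
    (auto simp: inj_stone stone_in_O_R neg_top stone_bot stone_top stone_inf stone_sup stone_neg
      stone_wimp)

end
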